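(* Let $(A,\pi)$ be a partitioned quiver with $\pi=\pi_1/\pi_2/\cdots/\pi_\ell$, and let $\sigma_1,\sigma_2,\dots,\sigma_\ell$ be reddening sequences for the components $A_1,A_2,\dots,A_\ell$ respectively. Suppose $A$ admits a reddening sequence $\tau$ which is a component preserving shuffle of $\sigma_1,\sigma_2,\dots,\sigma_\ell$, and let $(B,\pi)$ be a partitioned quiver such that $B$ $\pi$-dominates $A$. Then $\tau$ is also a reddening sequence for $B$. Moreover, if $\tau$ is a maximal green sequence for $A$, then $\tau$ is a maximal green sequence for $B$.
   Context: A quiver $Q$ is a finite directed multigraph with vertex set $V(Q)$ and edge set $E(Q)$ (edges are called arrows) without loops or 2-cycles. An ice quiver is a quiver with a designated set $F\subseteq V(Q)$ of frozen vertices with no arrows between elements of $F$; the other vertices are mutable. The framed quiver $\widehat{Q}$ has vertex set $V(Q)\sqcup\{v' : v\in V(Q)\}$, arrows $E(Q)\sqcup\{v\to v' : v\in V(Q)\}$, and frozen vertices $\{v' : v\in V(Q)\}$. Mutation $\mu_i$ at a mutable vertex $i$: (1) for each pair of arrows $j\to i$, $i\to k$ with $j,k$ not both frozen, add an arrow $j\to k$; (2) reverse all arrows incident to $i$; (3) delete a maximal collection of disjoint 2-cycles. The frozen set is unchanged. In an ice quiver obtained from a framed quiver by mutations, a mutable vertex is green if there are no arrows to it from frozen vertices, and red if there are no arrows from it to frozen vertices. By sign-coherence (known) every mutable vertex is either green or red. A (finite) sequence of mutable vertices $(k_1,\dots,k_N)$, mutated at in this order starting from $\widehat Q$, is a reddening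 sequence for $Q$ if all mutable vertices are red in the resulting quiver; it is a maximal green sequence if moreover each mutation is performed at a vertex that is green at that moment. A partitioned quiver $(Q,\pi)$ is a quiver with a set partition $\pi=\pi_1/\cdots/\pi_\ell$ of $V(Q)$; the component $Q_i$ is the induced subquiver on $\pi_i$. The partition $\widehat\pi$ of $V(\widehat Q)$ has parts $\widehat{\pi_i}=\{v,v' : v\in\pi_i\}$. Mutation does not change the partition. Let $R$ be an ice quiver obtained from $\widehat Q$ by mutations, with partition $\widehat\pi$ and components $R_i$ (induced subquivers on $\widehat{\pi_i}$). A mutable vertex $k\in V(R_i)$ is component preserving with respect to $\widehat\pi$ if one of the following occurs: (i) there is an arrow $k\to j'$ with $j'$ frozen, and every arrow $a\to k$ of $R$ has $a\in V(R_i)$; or (ii) there is an arrow $j'\to k$ with $j'$ frozen, and every arrow $k\to a$ of $R$ has $a\in V(R_i)$. A shuffle of several sequences is a sequence whose entries are exactly those of the given sequences (as a multiset union), with the relative order of each given sequence preserved. A shuffle $\tau=(k_1,\dots,k_N)$ is component preserving (for $(Q,\pi)$) if for each $t$ the vertex $k_t$ is component preserving with respect to $\widehat\pi$ in $\mu_{k_{t-1}}\circ\cdots\circ\mu_{k_1}(\widehat{Q})$. For partitioned quivers $(A,\pi)$, $(B,\pi)$ on the same vertex set with the same partition, $B$ $\pi$-dominates $A$ if: $A_i=B_i$ for each $i$; and there are positive integers $d_{ij}=d_{ji}$ ($i\ne j$), depending only on the pair of components, such that for all $u\in\pi_i$, $v\in\pi_j$ with $i\neq j$, $\#(u\to v\text{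 in }B)=d_{ij}\cdot\#(u\to v\text{ in }A)$, where arrows in the opposite direction are counted as negative. *)

theory Defs
  imports Main "HOL-Library.Disjoint_Sets"
begin

text \<open>A finite directed multigraph is recorded by its vertex set and the number of arrows
  between each ordered pair of vertices.\<close>

record 'v quiver =
  verts :: "'v set"
  arr :: "'v \<Rightarrow> 'v \<Rightarrow> nat"

record 'v ice_quiver = "'v quiver" +
  frozen :: "'v set"

definition is_quiver :: "('v, 'z) quiver_scheme \<Rightarrow> bool" where
  "is_quiver Q \<longleftrightarrow>
     finite (verts Q) \<and>
     (\<forall>u v. arr Q u v > 0 \<longrightarrow> u \<in> verts Q \<and> v \<in> verts Q) \<and>
     (\<forall>v. arr Q v v = 0) \<and>
     (\<forall>u v. arr Q u v = 0 \<or> arr Q v u = 0)"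

definition is_ice_quiver :: "('v, 'z) ice_quiver_scheme \<Rightarrow> bool" where
  "is_ice_quiver R \<longleftrightarrow>
     is_quiver R \<and> frozen R \<subseteq> verts R \<and> (\<forall>u\<in>frozen R. \<forall>v\<in>frozen R. arr R u v = 0)"

definition mutable :: "('v, 'z) ice_quiver_scheme \<Rightarrow> 'v set" where
  "mutable R = verts R - frozen R"

text \<open>In the framed quiver, \<open>Inl v\<close> is the mutable vertex \<open>v\<close> and \<open>Inr v\<close> its frozen copy \<open>v'\<close>.\<close>

fun framed_arr :: "('v, 'z) quiver_scheme \<Rightarrow> 'v + 'v \<Rightarrow> 'v + 'v \<Rightarrow> nat" where
  "framed_arr Q (Inl u) (Inl v) = arr Q u v"
| "framed_arr Q (Inl u) (Inr v) = (if u = v \<and> u \<in> verts Q then 1 else 0)"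
| "framed_arr Q (Inr u) w = 0"

definition framed :: "'v quiver \<Rightarrow> ('v + 'v) ice_quiver" where
  "framed Q = \<lparr>verts = Inl ` verts Q \<union> Inr ` verts Q, arr = framed_arr Q,
               frozen = Inr ` verts Q\<rparr>"

text \<open>The three steps of mutation at \<open>i\<close>, on arrow multiplicities. In the last step truncated
  subtraction leaves exactly the arrows surviving the deletion of a maximal collection of
  disjoint 2-cycles.\<close>

definition add_paths :: "'v set \<Rightarrow> 'v \<Rightarrow> ('v \<Rightarrow> 'v \<Rightarrow> nat) \<Rightarrow> 'v \<Rightarrow> 'v \<Rightarrow> nat" where
  "add_paths F i a = (\<lambda>j k. a j k + (if j \<in> F \<and> k \<in> F then 0 else a j i * a i k))"

definition reverse_at :: "'v \<Rightarrow> ('v \<Rightarrow> 'v \<Rightarrow> nat) \<Rightarrow> 'v \<Rightarrow> 'v \<Rightarrow> nat" where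
  "reverse_at i a = (\<lambda>j k. if j = i \<or> k = i then a k j else a j k)"

definition cancel_two_cycles :: "('v \<Rightarrow> 'v \<Rightarrow> nat) \<Rightarrow> 'v \<Rightarrow> 'v \<Rightarrow> nat" where
  "cancel_two_cycles a = (\<lambda>j k. a j k - a k j)"

definition mutate :: "'v \<Rightarrow> 'v ice_quiver \<Rightarrow> 'v ice_quiver" where
  "mutate i R = R\<lparr>arr := cancel_two_cycles (reverse_at i (add_paths (frozen R) i (arr R)))\<rparr>"

text \<open>Starting from the framed quiver of \<open>Q\<close>, mutate at the entries of the list, head first.\<close>

definition mutate_framed :: "'v quiver \<Rightarrow> 'v list \<Rightarrow> ('v + 'v) ice_quiver" where
  "mutate_framed Q ks = fold (\<lambda>k. mutate (Inl k)) ks (framed Q)"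

definition green :: "'v ice_quiver \<Rightarrow> 'v \<Rightarrow> bool" where
  "green R k \<longleftrightarrow> k \<in> mutable R \<and> (\<forall>f\<in>frozen R. arr R f k = 0)"

definition red :: "'v ice_quiver \<Rightarrow> 'v \<Rightarrow> bool" where
  "red R k \<longleftrightarrow> k \<in> mutable R \<and> (\<forall>f\<in>frozen R. arr R k f = 0)"

definition reddening_seq :: "'v quiver \<Rightarrow> 'v list \<Rightarrow> bool" where
  "reddening_seq Q ks \<longleftrightarrow>
     set ks \<subseteq> verts Q \<and> (\<forall>v\<in>mutable (mutate_framed Q ks). red (mutate_framed Q ks) v)"

definition maximal_green_seq :: "'v quiver \<Rightarrow> 'v list \<Rightarrow> bool" where
  "maximal_green_seq Q ks \<longleftrightarrow>
     reddening_seq Q ks \<and>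
     (\<forall>t<length ks. green (mutate_framed Q (take t ks)) (Inl (ks ! t)))"

definition partitioned_quiver :: "'v quiver \<Rightarrow> 'v set list \<Rightarrow> bool" where
  "partitioned_quiver Q \<pi> \<longleftrightarrow>
     is_quiver Q \<and> distinct \<pi> \<and> partition_on (verts Q) (set \<pi>)"

definition induced :: "'v quiver \<Rightarrow> 'v set \<Rightarrow> 'v quiver" where
  "induced Q S = \<lparr>verts = verts Q \<inter> S,
                  arr = (\<lambda>u v. if u \<in> S \<and> v \<in> S then arr Q u v else 0)\<rparr>"

definition hat_partition :: "'v set list \<Rightarrow> ('v + 'v) set list" where
  "hat_partition \<pi> = map (\<lambda>p. Inl ` p \<union> Inr ` p) \<pi>"

definition component_preserving :: "'v ice_quiver \<Rightarrow> 'v set list \<Rightarrow> 'v \<Rightarrow> bool" where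
  "component_preserving R \<rho> k \<longleftrightarrow>
     k \<in> mutable R \<and>
     (\<exists>p\<in>set \<rho>. k \<in> p \<and>
        ((\<exists>f\<in>frozen R. arr R k f > 0) \<and> (\<forall>a. arr R a k > 0 \<longrightarrow> a \<in> p) \<or>
         (\<exists>f\<in>frozen R. arr R f k > 0) \<and> (\<forall>a. arr R k a > 0 \<longrightarrow> a \<in> p)))"

fun shuffles_of :: "'a list list \<Rightarrow> 'a list set" where
  "shuffles_of [] = {[]}"
| "shuffles_of (xs # xss) = (\<Union>ys\<in>shuffles_of xss. shuffles xs ys)"

definition component_preserving_seq :: "'v quiver \<Rightarrow> 'v set list \<Rightarrow> 'v list \<Rightarrow> bool" where
  "component_preserving_seq Q \<pi> \<tau> \<longleftrightarrow>
     (\<forall>t<length \<tau>.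
        component_preserving (mutate_framed Q (take t \<tau>)) (hat_partition \<pi>) (Inl (\<tau> ! t)))"

definition net_arr :: "'v quiver \<Rightarrow> 'v \<Rightarrow> 'v \<Rightarrow> int" where
  "net_arr Q u v = int (arr Q u v) - int (arr Q v u)"

definition dominates :: "'v set list \<Rightarrow> 'v quiver \<Rightarrow> 'v quiver \<Rightarrow> bool" where
  "dominates \<pi> B A \<longleftrightarrow>
     (\<forall>i<length \<pi>. induced A (\<pi> ! i) = induced B (\<pi> ! i)) \<and>
     (\<exists>d :: nat \<Rightarrow> nat \<Rightarrow> nat.
        \<forall>i<length \<pi>. \<forall>j<length \<pi>. i \<noteq> j \<longrightarrow>
          d i j > 0 \<and> d i j = d j i \<and>
          (\<forall>u\<in>\<pi> ! i. \<forall>v\<in>\<pi> ! j. net_arr B u v = int (d i j) * net_arr A u v))"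

lemma is_ice_quiver_framed:
  assumes "is_quiver Q"
  shows "is_ice_quiver (framed Q)"
proof -
  have "x \<in> verts (framed Q) \<and> y \<in> verts (framed Q)" if "framed_arr Q x y > 0" for x y
    using assms that
    by (cases x; cases y) (auto simp: framed_def is_quiver_def split: if_splits)
  moreover have "framed_arr Q x x = 0" for x
    using assms by (cases x) (auto simp: is_quiver_def)
  moreover have "framed_arr Q x y = 0 \<or> framed_arr Q y x = 0" for x y
    using assms by (cases x; cases y) (auto simp: is_quiver_def)
  moreover have "finite (verts (framed Q))" "frozen (framed Q) \<subseteq> verts (framed Q)"
    "arr (framed Q) = framed_arr Q"
    using assms by (auto simp: framed_def is_quiver_def)
  moreover have "framed_arr Q x y = 0" if "x \<in> frozen (framed Q)" for x y
    using that by (auto simp: framed_def)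
  ultimately show ?thesis
    unfolding is_ice_quiver_def is_quiver_def by simp
qed

lemma is_ice_quiver_mutate:
  assumes R: "is_ice_quiver R" and i: "i \<in> mutable R"
  shows "is_ice_quiver (mutate i R)"
proof -
  define a where "a = arr R"
  define b where "b = reverse_at i (add_paths (frozen R) i a)"
  have m: "arr (mutate i R) = cancel_two_cycles b"
    "verts (mutate i R) = verts R" "frozen (mutate i R) = frozen R"
    by (simp_all add: mutate_def a_def b_def)
  have a0: "a u v = 0" "a v u = 0" if "u \<notin> verts R" for u v
    using R that unfolding is_ice_quiver_def is_quiver_def a_def by (metis gr0I)+
  have b0: "b u v = 0" "b v u = 0" if "u \<notin> verts R" for u v
  proof -
    have "u \<noteq> i"
      using i that unfolding mutable_def by blast
    then show "b u v = 0" "b v u = 0"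
      unfolding b_def reverse_at_def add_paths_def by (simp_all add: a0[OF that])
  qed
  have supp: "u \<in> verts R \<and> v \<in> verts R" if "cancel_two_cycles b u v > 0" for u v
    using that b0[of u v] b0[of v u] unfolding cancel_two_cycles_def by (metis diff_0_eq_0 less_nat_zero_code)
  have froz: "cancel_two_cycles b u v = 0" if "u \<in> frozen R" "v \<in> frozen R" for u v
  proof -
    have "u \<noteq> i" "v \<noteq> i" "a u v = 0"
      using R i that unfolding is_ice_quiver_def mutable_def a_def by blast+
    then show ?thesis
      using that by (simp add: cancel_two_cycles_def b_def reverse_at_def add_paths_def)
  qed
  have "cancel_two_cycles b u u = 0" for u
    by (simp add: cancel_two_cycles_def)
  moreover have "cancel_two_cycles b u v = 0 \<or> cancel_two_cycles b v u = 0" for u v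
    unfolding cancel_two_cycles_def by linarith
  moreover have "finite (verts R)" "frozen R \<subseteq> verts R"
    using R unfolding is_ice_quiver_def is_quiver_def by blast+
  ultimately show ?thesis
    unfolding is_ice_quiver_def is_quiver_def m using supp froz by blast
qed

end

theory Submission
  imports Defs
begin

text \<open>Every entry of the framed quiver of \<open>B\<close> is the entry for \<open>A\<close> times a positive weight that
  depends symmetrically on the two components and is \<open>1\<close> within a component. This relation survives
  mutation at a component preserving vertex \<open>k\<close>: in each path \<open>j \<rightarrow> k \<rightarrow> l\<close> one of the two arrows
  stays in the component of \<open>k\<close>, so the weights of the arrows multiply to the weight of \<open>(j, l)\<close>.
  Hence arrows exist in the same places along both mutation sequences, and so do the colours.
  Letting the weights apply also to arrows at frozen vertices makes sign-coherence unnecessary.\<close>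

definition scaled_by :: "('v \<Rightarrow> 'v \<Rightarrow> nat) \<Rightarrow> 'v ice_quiver \<Rightarrow> 'v ice_quiver \<Rightarrow> bool" where
  "scaled_by D R S \<longleftrightarrow>
     verts S = verts R \<and> frozen S = frozen R \<and> (\<forall>x y. arr S x y = D x y * arr R x y)"

text \<open>The hypothesis \<open>paths\<close> lets the arrows created by mutation scale like those
  already present between the same vertices. Symmetry of \<open>D\<close> carries the scaling
  through reversal and cancellation, which mix both directions.\<close>

lemma scaled_by_mutate:
  assumes scaled: "scaled_by D R S"
    and sym: "\<And>x y. D x y = D y x"
    and paths: "\<And>j l. arr R j k > 0 \<Longrightarrow> arr R k l > 0 \<Longrightarrow> D j k * D k l = D j l"
  shows "scaled_by D (mutate k R) (mutate k S)"
proof -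
  have S: "verts S = verts R" "frozen S = frozen R" "\<And>x y. arr S x y = D x y * arr R x y"
    using scaled by (auto simp: scaled_by_def)
  \<comment> \<open>When one of the two arrows is absent in \<open>R\<close>, both sides vanish, so
    multiplicativity of \<open>D\<close> matters only along actual paths.\<close>
  have path: "arr S j k * arr S k l = D j l * (arr R j k * arr R k l)" for j l
  proof (cases "arr R j k > 0 \<and> arr R k l > 0")
    case True
    then have "D j l = D j k * D k l"
      using paths by metis
    then show ?thesis
      by (simp add: S(3))
  qed (auto simp: S(3))
  have "add_paths (frozen S) k (arr S) j l = D j l * add_paths (frozen R) k (arr R) j l" for j l
    unfolding add_paths_def path by (simp add: S(2,3) distrib_left)
  then have "reverse_at k (add_paths (frozen S) k (arr S)) j l
      = D j l * reverse_at k (add_paths (frozen R) k (arr R)) j l" for j l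
    unfolding reverse_at_def using sym by simp
  \<comment> \<open>Truncated subtraction commutes with a common factor, and
    \<open>D j l = D l j\<close> makes the factor common.\<close>
  then have "arr (mutate k S) j l = D j l * arr (mutate k R) j l" for j l
    unfolding mutate_def cancel_two_cycles_def
    by (simp add: diff_mult_distrib2 sym[of l j])
  then show ?thesis
    by (simp add: scaled_by_def S mutate_def)
qed

text \<open>Positive weights preserve which entries vanish, and colours depend on nothing
  else.\<close>

lemma scaled_by_green_iff:
  assumes "scaled_by D R S" and "\<And>x y. D x y > 0"
  shows "green S x \<longleftrightarrow> green R x"
  using assms unfolding scaled_by_def green_def mutable_def
  by (metis less_not_refl mult_is_0)

lemma scaled_by_red_iff:
  assumes "scaled_by D R S" and "\<And>x y. D x y > 0"
  shows "red S x \<longleftrightarrow> red R x"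
  using assms unfolding scaled_by_def red_def mutable_def
  by (metis less_not_refl mult_is_0)

definition part_index :: "'v set list \<Rightarrow> 'v \<Rightarrow> nat" where
  "part_index \<pi> v = (THE i. i < length \<pi> \<and> v \<in> \<pi> ! i)"

lemma part_index_eq:
  assumes "partitioned_quiver Q \<pi>" "i < length \<pi>" "v \<in> \<pi> ! i"
  shows "part_index \<pi> v = i"
  unfolding part_index_def
proof (rule the_equality)
  fix j assume j: "j < length \<pi> \<and> v \<in> \<pi> ! j"
  have "disjoint (set \<pi>)" "distinct \<pi>"
    using assms(1) by (auto simp: partitioned_quiver_def partition_on_def)
  moreover have "\<pi> ! i = \<pi> ! j"
    using disjointD[OF \<open>disjoint (set \<pi>)\<close>, of "\<pi> ! i" "\<pi> ! j"] j assms(2,3) by auto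
  ultimately show "j = i"
    using j assms(2) by (simp add: nth_eq_iff_index_eq)
qed (use assms in simp)

lemma part_index_mem:
  assumes "partitioned_quiver Q \<pi>" "v \<in> verts Q"
  shows "part_index \<pi> v < length \<pi> \<and> v \<in> \<pi> ! part_index \<pi> v"
proof -
  have "\<Union> (set \<pi>) = verts Q"
    using assms(1) by (simp add: partitioned_quiver_def partition_on_def)
  then obtain i where "i < length \<pi>" "v \<in> \<pi> ! i"
    using assms(2) by (metis UnionE in_set_conv_nth)
  then show ?thesis
    using part_index_eq[OF assms(1)] by metis
qed

text \<open>A frozen copy inherits the component of its original, in line with
  \<open>hat_partition\<close>.\<close>

definition component_of :: "'v set list \<Rightarrow> 'v + 'v \<Rightarrow> nat" where
  "component_of \<pi> x = part_index \<pi> (case x of Inl v \<Rightarrow> v | Inr v \<Rightarrow> v)"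

lemma component_of_hat_partition:
  assumes "partitioned_quiver Q \<pi>" "p \<in> set (hat_partition \<pi>)" "x \<in> p" "y \<in> p"
  shows "component_of \<pi> x = component_of \<pi> y"
proof -
  obtain i where "i < length \<pi>" "p = Inl ` (\<pi> ! i) \<union> Inr ` (\<pi> ! i)"
    using assms(2) by (auto simp: hat_partition_def in_set_conv_nth)
  then show ?thesis
    using assms(3,4) part_index_eq[OF assms(1)] by (auto simp: component_of_def)
qed

text \<open>Turns the signed counts of domination into an entrywise scaling of \<open>arr\<close>,
  with weights that are total functions on indices.\<close>

lemma dominates_weights:
  assumes A: "partitioned_quiver A \<pi>" and B: "partitioned_quiver B \<pi>"
    and dom: "dominates \<pi> B A"
  obtains w :: "nat \<Rightarrow> nat \<Rightarrow> nat"
  where "\<And>i j. w i j > 0" "\<And>i j. w i j = w j i" "\<And>i. w i i = 1"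
    "\<And>u v. arr B u v = w (part_index \<pi> u) (part_index \<pi> v) * arr A u v"
proof -
  obtain d :: "nat \<Rightarrow> nat \<Rightarrow> nat" where d: "\<And>i j. i < length \<pi> \<Longrightarrow> j < length \<pi> \<Longrightarrow> i \<noteq> j \<Longrightarrow>
      d i j > 0 \<and> d i j = d j i \<and>
      (\<forall>u\<in>\<pi> ! i. \<forall>v\<in>\<pi> ! j. net_arr B u v = int (d i j) * net_arr A u v)"
    using dom unfolding dominates_def by blast
  have ind: "induced A (\<pi> ! i) = induced B (\<pi> ! i)" if "i < length \<pi>" for i
    using dom that unfolding dominates_def by blast
  \<comment> \<open>\<open>d\<close> is constrained only at distinct valid indices. The default
    \<open>1\<close> gives positivity and symmetry everywhere, and on the diagonal it expresses
    equality of the components.\<close>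
  define w where "w i j = (if i < length \<pi> \<and> j < length \<pi> \<and> i \<noteq> j then d i j else 1)" for i j
  have "arr B u v = w (part_index \<pi> u) (part_index \<pi> v) * arr A u v" for u v
  proof (cases "u \<in> verts A \<and> v \<in> verts A")
    case False
    moreover have "verts A = verts B"
      using A B by (metis partition_on_def partitioned_quiver_def)
    ultimately have "arr A u v = 0" "arr B u v = 0"
      using A B unfolding partitioned_quiver_def is_quiver_def by (metis gr0I)+
    then show ?thesis
      by simp
  next
    case True
    define i where "i = part_index \<pi> u"
    define j where "j = part_index \<pi> v"
    have ij: "i < length \<pi>" "u \<in> \<pi> ! i" "j < length \<pi>" "v \<in> \<pi> ! j"
      using True part_index_mem[OF A] by (auto simp: i_def j_def)
    have "arr B u v = w i j * arr A u v"
    proof (cases "i = j")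
      case True
      have "arr (induced A (\<pi> ! i)) u v = arr (induced B (\<pi> ! i)) u v"
        using ind[OF ij(1)] by simp
      then show ?thesis
        using ij True by (simp add: induced_def w_def)
    next
      case False
      then have "net_arr B u v = int (w i j) * net_arr A u v"
        using d ij by (simp add: w_def)
      \<comment> \<open>Without 2-cycles the arrow count is the positive part of the net
        count.\<close>
      moreover have "arr Q u v = nat (net_arr Q u v)" if "partitioned_quiver Q \<pi>" for Q
      proof -
        have "arr Q u v = 0 \<or> arr Q v u = 0"
          using that by (simp add: partitioned_quiver_def is_quiver_def)
        then show ?thesis
          by (auto simp: net_arr_def)
      qed
      ultimately show ?thesis
        using A B by (simp add: nat_mult_distrib)
    qed
    then show ?thesis
      by (simp add: i_def j_def)
  qed
  then show ?thesis
    using that[of w] d by (auto simp: w_def)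
qed

text \<open>Induction on the prefix length. Component preservation is assumed for \<open>A\<close>
  alone, which suffices because the path condition of \<open>scaled_by_mutate\<close> concerns only
  the quiver being scaled.\<close>

lemma scaled_by_mutate_framed:
  fixes w :: "nat \<Rightarrow> nat \<Rightarrow> nat" and \<pi> :: "'v set list"
  defines "D \<equiv> \<lambda>x y. w (component_of \<pi> x) (component_of \<pi> y)"
  assumes A: "partitioned_quiver A \<pi>" and verts: "verts B = verts A"
    and w_sym: "\<And>i j. w i j = w j i" and w_refl: "\<And>i. w i i = 1"
    and arr_B: "\<And>u v. arr B u v = w (part_index \<pi> u) (part_index \<pi> v) * arr A u v"
    and pres: "component_preserving_seq A \<pi> \<tau>"
    and "t \<le> length \<tau>"
  shows "scaled_by D (mutate_framed A (take t \<tau>)) (mutate_framed B (take t \<tau>))"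
  using \<open>t \<le> length \<tau>\<close>
proof (induction t)
  case 0
  \<comment> \<open>The framing arrows from \<open>v\<close> to its copy stay within one component,
    so they have weight \<open>1\<close>.\<close>
  have "framed_arr B x y = D x y * framed_arr A x y" for x y
    by (cases x; cases y) (auto simp: D_def component_of_def arr_B w_refl verts)
  then show ?case
    by (simp add: scaled_by_def mutate_framed_def framed_def verts)
next
  case (Suc t)
  define R where "R = mutate_framed A (take t \<tau>)"
  define k :: "'v + 'v" where "k = Inl (\<tau> ! t)"
  have "component_preserving R (hat_partition \<pi>) k"
    using pres Suc.prems by (auto simp: component_preserving_seq_def R_def k_def)
  then obtain p where p: "p \<in> set (hat_partition \<pi>)" "k \<in> p"
    "(\<forall>a. arr R a k > 0 \<longrightarrow> a \<in> p) \<or> (\<forall>a. arr R k a > 0 \<longrightarrow> a \<in> p)"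
    unfolding component_preserving_def by blast
  have "D j k * D k l = D j l" if "arr R j k > 0" "arr R k l > 0" for j l
  proof -
    \<comment> \<open>If \<open>j\<close> lies with \<open>k\<close>, then \<open>D j k = 1\<close>
      and \<open>D k l = D j l\<close>; the other case is symmetric.\<close>
    have "component_of \<pi> j = component_of \<pi> k \<or> component_of \<pi> l = component_of \<pi> k"
      using p that component_of_hat_partition[OF A p(1)] by blast
    then show ?thesis
      by (auto simp: D_def w_refl)
  qed
  moreover have "scaled_by D R (mutate_framed B (take t \<tau>))"
    using Suc by (simp add: R_def)
  ultimately have "scaled_by D (mutate k R) (mutate k (mutate_framed B (take t \<tau>)))"
    using w_sym by (intro scaled_by_mutate) (auto simp: D_def)
  then show ?case
    using Suc.prems by (simp add: take_Suc_conv_app_nth mutate_framed_def R_def k_def)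
qed

theorem corollary4p6:
  fixes A B :: "'v quiver" and \<pi> :: "'v set list" and \<sigma> :: "'v list list" and \<tau> :: "'v list"
  assumes "partitioned_quiver A \<pi>"
    and "length \<sigma> = length \<pi>"
    and "\<forall>i<length \<pi>. reddening_seq (induced A (\<pi> ! i)) (\<sigma> ! i)"
    and "reddening_seq A \<tau>"
    and "\<tau> \<in> shuffles_of \<sigma>"
    and "component_preserving_seq A \<pi> \<tau>"
    and "partitioned_quiver B \<pi>"
    and "dominates \<pi> B A"
  shows "reddening_seq B \<tau> \<and> (maximal_green_seq A \<tau> \<longrightarrow> maximal_green_seq B \<tau>)"
proof -
  obtain w :: "nat \<Rightarrow> nat \<Rightarrow> nat" where w: "\<And>i j. w i j > 0" "\<And>i j. w i j = w j i" "\<And>i. w i i = 1"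
    "\<And>u v. arr B u v = w (part_index \<pi> u) (part_index \<pi> v) * arr A u v"
    using dominates_weights[OF assms(1,7,8)] by metis
  define D where "D = (\<lambda>x y. w (component_of \<pi> x) (component_of \<pi> y))"
  have D_pos: "D x y > 0" for x y
    by (simp add: D_def w(1))
  have verts: "verts B = verts A"
    using assms(1,7) by (metis partition_on_def partitioned_quiver_def)
  \<comment> \<open>All prefixes are compared because a maximal green sequence constrains the colour
    before each mutation.\<close>
  have scaled: "scaled_by D (mutate_framed A (take t \<tau>)) (mutate_framed B (take t \<tau>))"
    if "t \<le> length \<tau>" for t
    unfolding D_def using scaled_by_mutate_framed[OF assms(1) verts w(2-4) assms(6) that] .
  have final: "scaled_by D (mutate_framed A \<tau>) (mutate_framed B \<tau>)"
    using scaled[of "length \<tau>"] by simp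
  then have "mutable (mutate_framed B \<tau>) = mutable (mutate_framed A \<tau>)"
    by (simp add: scaled_by_def mutable_def)
  then have red: "reddening_seq B \<tau>"
    using assms(4) scaled_by_red_iff[OF final D_pos] by (simp add: reddening_seq_def verts)
  have "green (mutate_framed B (take t \<tau>)) x \<longleftrightarrow> green (mutate_framed A (take t \<tau>)) x"
    if "t < length \<tau>" for t x
    using scaled_by_green_iff[OF scaled D_pos] that by simp
  then show ?thesis
    using red by (simp add: maximal_green_seq_def)
qed

end
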